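(* Let $d\ge2$ be an integer and $r,\varepsilon>0$ with $\varepsilon\le e^r r$. Then the function $\phi:(0,\infty)\to(0,\infty)$, $$\phi(N)=\frac{d^{N+1}}{(d-1)N}\bigg(\frac{e^r r^{N+1}}{\varepsilon\,(N+1)!}\bigg)^{1/N},$$ satisfies $\phi(N)\to+\infty$ as $N\to0^+$ and as $N\to+\infty$, and is strictly convex on $(0,+\infty)$. Consequently the constrained optimisation problem $$\text{minimise } f_d(N,m):=m\,\frac{d^{N+1}}{(d-1)N}\ \text{ over } (N,m)\in(0,\infty)^2\quad\text{subject to } g_r(N,m):=\frac{r^{N+1}e^r}{(N+1)!\,m^N}=\varepsilon$$ admits a unique solution.
   Context: $N$ and $m$ are real variables, and $(N+1)!:=\Gamma(N+2)$ for real $N>0$. *)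

theory Defs
  imports "HOL-Analysis.Analysis"
begin

definition strictly_convex_on :: "'a::real_vector set \<Rightarrow> ('a \<Rightarrow> real) \<Rightarrow> bool" where
  "strictly_convex_on S f \<longleftrightarrow> convex S \<and>
     (\<forall>x\<in>S. \<forall>y\<in>S. \<forall>u>0. \<forall>v>0. u + v = 1 \<longrightarrow> x \<noteq> y \<longrightarrow>
        f (u *\<^sub>R x + v *\<^sub>R y) < u * f x + v * f y)"

(* The variables N and m below are positive reals, so powers are real powers, and
   (N+1)! stands for Gamma (N + 2). *)

definition phi :: "nat \<Rightarrow> real \<Rightarrow> real \<Rightarrow> real \<Rightarrow> real" where
  "phi d r \<epsilon> N =
     real d powr (N + 1) / ((real d - 1) * N) *
       (exp r * r powr (N + 1) / (\<epsilon> * Gamma (N + 2))) powr (1 / N)"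

definition cost :: "nat \<Rightarrow> real \<Rightarrow> real \<Rightarrow> real" where
  "cost d N m = m * (real d powr (N + 1) / ((real d - 1) * N))"

definition err :: "real \<Rightarrow> real \<Rightarrow> real \<Rightarrow> real" where
  "err r N m = r powr (N + 1) * exp r / (Gamma (N + 2) * m powr N)"

end

theory Submission
  imports Defs "HOL-Real_Asymp.Real_Asymp"
begin

text \<open>
  Everything rests on the logarithm of \<^term>\<open>phi d r \<epsilon>\<close>. With \<open>K = exp r * r / \<epsilon>\<close>, which is
  at least \<open>1\<close> by hypothesis, it is
  \<open>N ln d - ln N + ln (d r / (d - 1)) + ln K / N - ln \<Gamma>(N+2) / N\<close>.
  Here \<open>- ln N\<close> is strictly convex and the other terms are convex. For the last one, note that
  \<open>ln \<Gamma>(2) = 0\<close> (\<open>ln_Gamma_2\<close>), so \<open>ln \<Gamma>(N+2) / N\<close> is a difference quotient of \<open>ln \<Gamma>\<close> at the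
  point \<open>2\<close>, that is, the mean of the digamma function over \<open>[2, N+2]\<close>; it is concave in \<open>N\<close>
  because digamma is concave (\<open>concave_on_difference_quotient\<close>, \<open>concave_on_ln_Gamma_quotient\<close>).
  Hence the logarithm of \<open>\<phi>\<close> is strictly convex, and so is \<open>\<phi>\<close> itself.

  For the limits, \<open>\<Gamma>(N+2) \<le> (N+2)^N\<close> (\<open>ln_Gamma_add_2_le\<close>) and \<open>K \<ge> 1\<close>
  bound \<open>\<phi>(N)\<close> from below by \<open>d^(N+1) r / ((d-1) N (N+2))\<close> (\<open>phi_ge\<close>), which
  tends to infinity at both ends of the half-line.

  A strictly convex function on the half-line that tends to infinity at both ends has exactly one
  minimiser (\<open>strictly_convex_ex1_minimiser\<close>). This settles the constrained problem, because the
  constraint determines \<open>m\<close> as a function of \<open>N\<close>, and the cost along the constraint curve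
  is \<open>\<phi>(N)\<close> (\<open>err_eq_iff\<close>, \<open>cost_constraint_m\<close>).
\<close>


section \<open>Strict convexity\<close>

lemma strictly_convex_on_add_convex_on:
  assumes "strictly_convex_on S f" and "convex_on S g"
  shows "strictly_convex_on S (\<lambda>x. f x + g x)"
  unfolding strictly_convex_on_def
proof (intro conjI ballI allI impI)
  show "convex S" using assms(1) by (simp add: strictly_convex_on_def)
  fix x y and u v :: real
  assume *: "x \<in> S" "y \<in> S" "u > 0" "v > 0" "u + v = 1" "x \<noteq> y"
  have "f (u *\<^sub>R x + v *\<^sub>R y) < u * f x + v * f y"
    using assms(1) * by (auto simp: strictly_convex_on_def)
  moreover have "g (u *\<^sub>R x + v *\<^sub>R y) \<le> u * g x + v * g y"
    using assms(2) * by (auto simp: convex_on_def)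
  ultimately show "f (u *\<^sub>R x + v *\<^sub>R y) + g (u *\<^sub>R x + v *\<^sub>R y)
      < u * (f x + g x) + v * (f y + g y)"
    by (simp add: algebra_simps)
qed

lemma strictly_convex_on_exp:
  assumes "strictly_convex_on S f"
  shows "strictly_convex_on S (\<lambda>x. exp (f x))"
  unfolding strictly_convex_on_def
proof (intro conjI ballI allI impI)
  show "convex S" using assms(1) by (simp add: strictly_convex_on_def)
  fix x y and u v :: real
  assume *: "x \<in> S" "y \<in> S" "u > 0" "v > 0" "u + v = 1" "x \<noteq> y"
  have "f (u *\<^sub>R x + v *\<^sub>R y) < u * f x + v * f y"
    using assms(1) * by (auto simp: strictly_convex_on_def)
  hence "exp (f (u *\<^sub>R x + v *\<^sub>R y)) < exp (u * f x + v * f y)"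
    by simp
  also have "\<dots> \<le> u * exp (f x) + v * exp (f y)"
    using exp_convex * unfolding convex_on_def by (auto dest: spec[of _ u])
  finally show "exp (f (u *\<^sub>R x + v *\<^sub>R y)) < u * exp (f x) + v * exp (f y)" .
qed

lemma strictly_convex_on_imp_convex_on:
  assumes "strictly_convex_on S f"
  shows "convex_on S f"
  unfolding convex_on_def
proof (intro conjI ballI allI impI)
  show "convex S" using assms(1) by (simp add: strictly_convex_on_def)
  fix x y and u v :: real
  assume *: "x \<in> S" "y \<in> S" "u \<ge> 0" "v \<ge> 0" "u + v = 1"
  show "f (u *\<^sub>R x + v *\<^sub>R y) \<le> u * f x + v * f y"
  proof (cases "u = 0 \<or> v = 0 \<or> x = y")
    case True
    with * show ?thesis
      by (auto simp flip: scaleR_left_distrib distrib_right)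
  next
    case False
    with * have "u > 0" "v > 0" "x \<noteq> y" by auto
    with * assms show ?thesis
      by (simp add: strictly_convex_on_def less_imp_le)
  qed
qed

lemma ln_less_minus_one:
  fixes x :: real
  assumes "x > 0" and "x \<noteq> 1"
  shows "ln x < x - 1"
  using assms ln_le_minus_one[of x] ln_eq_minus_one[of x] by linarith

lemma strictly_convex_on_minus_ln: "strictly_convex_on {0<..} (\<lambda>x::real. - ln x)"
  unfolding strictly_convex_on_def
proof (intro conjI ballI allI impI)
  fix x y u v :: real
  assume *: "x \<in> {0<..}" "y \<in> {0<..}" "u > 0" "v > 0" "u + v = 1" "x \<noteq> y"
  define z where "z = u * x + v * y"
  have z: "z > 0"
    using * by (simp add: z_def add_pos_pos)
  have "x - z = v * (x - y)" "y - z = u * (y - x)"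
    unfolding z_def using \<open>u + v = 1\<close> by algebra+
  with * have "x \<noteq> z" "y \<noteq> z" by auto
  \<comment> \<open>The graph of \<open>ln\<close> lies strictly below its tangent at \<open>z\<close>.\<close>
  have tangent: "ln w - ln z < w / z - 1" if "w > 0" "w \<noteq> z" for w
    using ln_less_minus_one[of "w / z"] that z by (simp add: ln_div)
  have "u * (ln x - ln z) + v * (ln y - ln z) < u * (x / z - 1) + v * (y / z - 1)"
    using * \<open>x \<noteq> z\<close> \<open>y \<noteq> z\<close> by (intro add_strict_mono mult_strict_left_mono tangent) auto
  also have "\<dots> = (u * x + v * y) / z - (u + v)"
    by (simp add: algebra_simps add_divide_distrib)
  also have "\<dots> = 0"
    using z \<open>u + v = 1\<close> by (simp flip: z_def)
  finally have "u * ln x + v * ln y < (u + v) * ln z"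
    by (simp add: algebra_simps)
  thus "- ln (u *\<^sub>R x + v *\<^sub>R y) < u * - ln x + v * - ln y"
    using \<open>u + v = 1\<close> by (simp add: z_def)
qed auto

lemma strictly_convex_ex1_minimiser:
  fixes f :: "real \<Rightarrow> real"
  assumes conv: "strictly_convex_on {0<..} f"
    and lim0: "filterlim f at_top (at_right 0)"
    and lim_inf: "filterlim f at_top at_top"
  shows "\<exists>!x. x > 0 \<and> (\<forall>y>0. f x \<le> f y)"
proof (rule ex_ex1I)
  have "\<forall>\<^sub>F x in at_right 0. f x \<ge> f 1"
    using lim0 by (simp add: filterlim_at_top)
  then obtain a where a: "a > 0" "\<And>x. 0 < x \<Longrightarrow> x < a \<Longrightarrow> f x \<ge> f 1"
    by (auto simp: eventually_at_right_field)
  have "\<forall>\<^sub>F x in at_top. f x \<ge> f 1"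
    using lim_inf by (simp add: filterlim_at_top)
  then obtain b where b: "\<And>x. x \<ge> b \<Longrightarrow> f x \<ge> f 1"
    by (auto simp: eventually_at_top_linorder)
  \<comment> \<open>The interval contains \<open>1\<close>, and at positive points outside it \<open>f\<close> is at least \<open>f 1\<close>.\<close>
  define I where "I = {min a 1..max b 1}"
  have I: "compact I" "1 \<in> I" "I \<subseteq> {0<..}"
    using a(1) by (auto simp: I_def)
  have "continuous_on {0<..} f"
    by (intro convex_on_continuous strictly_convex_on_imp_convex_on conv) auto
  hence "continuous_on I f"
    using I(3) by (rule continuous_on_subset)
  then obtain x where x: "x \<in> I" "\<And>y. y \<in> I \<Longrightarrow> f x \<le> f y"
    using continuous_attains_inf[of I f] I by blast
  have "f x \<le> f y" if "y > 0" for y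
  proof (cases "y \<in> I")
    case False
    hence "y < a \<or> y \<ge> b"
      by (auto simp: I_def)
    hence "f 1 \<le> f y"
      using a(2) b that by auto
    with x(2)[OF I(2)] show ?thesis by linarith
  qed (use x in auto)
  with x(1) I(3) show "\<exists>x. x > 0 \<and> (\<forall>y>0. f x \<le> f y)"
    by auto
next
  fix x y
  assume x: "x > 0 \<and> (\<forall>y>0. f x \<le> f y)" and y: "y > 0 \<and> (\<forall>z>0. f y \<le> f z)"
  show "x = y"
  proof (rule ccontr)
    assume "x \<noteq> y"
    have "\<forall>u>0. \<forall>v>0. u + v = 1 \<longrightarrow> f (u *\<^sub>R x + v *\<^sub>R y) < u * f x + v * f y"
      using conv x y \<open>x \<noteq> y\<close> by (simp add: strictly_convex_on_def)
    from this[rule_format, of "1/2" "1/2"]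
    have "f (x / 2 + y / 2) < f x / 2 + f y / 2"
      by simp
    moreover have "f x \<le> f (x / 2 + y / 2)" "f y \<le> f (x / 2 + y / 2)"
      using x y by auto
    ultimately show False by linarith
  qed
qed


section \<open>The logarithm of the Gamma function\<close>

text \<open>
  The difference quotient of \<open>f\<close> at \<open>0\<close> is the mean of \<open>f'\<close> over \<open>[0, x]\<close>, so it inherits
  concavity from \<open>f'\<close>. In the proof, its second derivative is \<open>- q x / x ^ 3\<close>, where
  \<open>q 0 = 0\<close> and \<open>q' x = - x\<^sup>2 f''' x\<close>.
\<close>

lemma concave_on_difference_quotient:
  fixes f f' f'' f''' :: "real \<Rightarrow> real"
  assumes f: "\<And>x. x \<ge> 0 \<Longrightarrow> (f has_real_derivative f' x) (at x)"
    and f': "\<And>x. x \<ge> 0 \<Longrightarrow> (f' has_real_derivative f'' x) (at x)"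
    and f'': "\<And>x. x \<ge> 0 \<Longrightarrow> (f'' has_real_derivative f''' x) (at x)"
    and neg: "\<And>x. x \<ge> 0 \<Longrightarrow> f''' x \<le> 0"
  shows "concave_on {0<..} (\<lambda>x. (f x - f 0) / x)"
proof -
  define q where "q x = 2 * x * f' x - x\<^sup>2 * f'' x - 2 * (f x - f 0)" for x
  have q': "(q has_real_derivative - (x\<^sup>2) * f''' x) (at x)" if "x \<ge> 0" for x
    unfolding q_def
    by (rule derivative_eq_intros f f' f'' that refl | simp add: power2_eq_square algebra_simps)+
  have q: "q x \<ge> 0" if "x > 0" for x
  proof -
    have "q 0 \<le> q x"
    proof (rule DERIV_nonneg_imp_nondecreasing[of 0 x q])
      show "0 \<le> x" using that by simp
      show "\<exists>y. (q has_real_derivative y) (at t) \<and> y \<ge> 0" if "0 \<le> t" for t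
        using q'[OF that] neg[OF that] by (auto simp: mult_nonneg_nonpos)
    qed
    thus ?thesis by (simp add: q_def)
  qed
  show ?thesis
  proof (rule f''_le0_imp_concave[where f' = "\<lambda>x. (x * f' x - (f x - f 0)) / x\<^sup>2"
          and f'' = "\<lambda>x. - q x / x ^ 3"])
    fix x :: real
    assume "x \<in> {0<..}"
    hence x: "x > 0" by simp
    show "((\<lambda>x. (f x - f 0) / x) has_real_derivative (x * f' x - (f x - f 0)) / x\<^sup>2) (at x)"
      using x by (auto intro!: derivative_eq_intros f simp: power2_eq_square field_simps)
    show "((\<lambda>x. (x * f' x - (f x - f 0)) / x\<^sup>2) has_real_derivative - q x / x ^ 3) (at x)"
      using x by (auto intro!: derivative_eq_intros f f'
          simp: q_def power2_eq_square power3_eq_cube field_simps)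
    show "- q x / x ^ 3 \<le> 0"
      using x q[OF x] by simp
  qed auto
qed

lemma ln_Gamma_2: "ln_Gamma (2 :: real) = 0"
  using Gamma_fact[of 1, where 'a = real] by (simp add: ln_Gamma_real_pos)

lemma concave_on_ln_Gamma_quotient:
  "concave_on {0<..} (\<lambda>x::real. ln_Gamma (x + 2) / x)"
proof -
  have "concave_on {0<..} (\<lambda>x::real. (ln_Gamma (x + 2) - ln_Gamma (0 + 2)) / x)"
  proof (rule concave_on_difference_quotient[where f' = "\<lambda>x. Polygamma 0 (x + 2)"
          and f'' = "\<lambda>x. Polygamma 1 (x + 2)" and f''' = "\<lambda>x. Polygamma 2 (x + 2)"])
    fix x :: real
    assume "x \<ge> 0"
    hence x: "x + 2 > 0" "x + 2 \<notin> \<int>\<^sub>\<le>\<^sub>0"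
      by (auto elim!: nonpos_Ints_cases)
    show "((\<lambda>x. ln_Gamma (x + 2)) has_real_derivative Polygamma 0 (x + 2)) (at x)"
         "((\<lambda>x. Polygamma 0 (x + 2)) has_real_derivative Polygamma 1 (x + 2)) (at x)"
         "((\<lambda>x. Polygamma 1 (x + 2)) has_real_derivative Polygamma 2 (x + 2)) (at x)"
      using x by (auto intro!: derivative_eq_intros simp: eval_nat_numeral)
    show "Polygamma 2 (x + 2) \<le> 0"
      using Polygamma_real_even_neg[of "x + 2" 2] x by simp
  qed
  thus ?thesis by (simp add: ln_Gamma_2)
qed

text \<open>
  Since digamma is increasing, its value at \<open>x\<close> is at most its mean over \<open>[x, x + 1]\<close>, which
  is \<open>ln (\<Gamma>(x + 1) / \<Gamma>(x)) = ln x\<close>.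
\<close>

lemma Digamma_real_le_ln:
  fixes x :: real
  assumes "x > 0"
  shows "Digamma x \<le> ln x"
proof -
  obtain t where t: "t > x" "t < x + 1"
      "ln_Gamma (x + 1) - ln_Gamma x = (x + 1 - x) * Digamma t"
    using assms by (metis MVT2[of x "x + 1" ln_Gamma Digamma] has_field_derivative_ln_Gamma_real
        less_add_one less_le_trans)
  have "Gamma (x + 1) = x * Gamma x"
    using assms by (intro Gamma_plus1) (auto elim!: nonpos_Ints_cases)
  hence "ln_Gamma (x + 1) - ln_Gamma x = ln x"
    using assms Gamma_real_pos[of x] by (simp add: ln_Gamma_real_pos ln_mult_pos)
  moreover have "Digamma x \<le> Digamma t"
    using assms t by (intro Digamma_real_mono) auto
  ultimately show ?thesis using t by simp
qed

lemma ln_Gamma_add_2_le: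
  fixes x :: real
  assumes "x > 0"
  shows "ln_Gamma (x + 2) \<le> x * ln (x + 2)"
proof -
  have "\<exists>t. 2 < t \<and> t < x + 2 \<and> ln_Gamma (x + 2) - ln_Gamma 2 = (x + 2 - 2) * Digamma t"
    using assms by (intro MVT2) (auto intro!: derivative_eq_intros)
  then obtain t where t: "2 < t" "t < x + 2" "ln_Gamma (x + 2) = x * Digamma t"
    by (auto simp: ln_Gamma_2)
  have "Digamma t \<le> Digamma (x + 2)"
    using t by (intro Digamma_real_mono) auto
  also have "\<dots> \<le> ln (x + 2)"
    using assms by (intro Digamma_real_le_ln) auto
  finally show ?thesis using t assms by simp
qed


section \<open>The function phi\<close>

text \<open>
  The summands are grouped as the strictly convex \<open>- ln N\<close> followed by convex functions of \<open>N\<close>.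
\<close>

lemma phi_eq_exp:
  assumes "d \<ge> 2" "r > 0" "\<epsilon> > 0" "N > 0"
  shows "phi d r \<epsilon> N = exp (- ln N + (- (ln_Gamma (N + 2) / N) +
           (N * ln (real d) + (ln (real d * r / (real d - 1)) + ln (exp r * r / \<epsilon>) * (1 / N)))))"
proof -
  have G: "Gamma (N + 2) > 0"
    using assms by (intro Gamma_real_pos) auto
  hence "ln (exp r * r powr (N + 1) / (\<epsilon> * Gamma (N + 2))) =
      ln (exp r * r / \<epsilon>) + N * ln r - ln_Gamma (N + 2)"
    and "exp r * r powr (N + 1) / (\<epsilon> * Gamma (N + 2)) > 0"
    using assms less_imp_neq[OF G]
    by (simp_all add: ln_mult ln_div ln_powr ln_Gamma_real_pos algebra_simps)
  hence "(exp r * r powr (N + 1) / (\<epsilon> * Gamma (N + 2))) powr (1 / N) =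
      exp (1 / N * (ln (exp r * r / \<epsilon>) + N * ln r - ln_Gamma (N + 2)))"
    using assms less_imp_neq[OF G] by (simp add: powr_def[of _ "1 / N"])
  also have "1 / N * (ln (exp r * r / \<epsilon>) + N * ln r - ln_Gamma (N + 2)) =
      ln (exp r * r / \<epsilon>) * (1 / N) + ln r - ln_Gamma (N + 2) / N"
    using assms by (simp only: ring_distribs) (simp add: diff_divide_distrib add_divide_distrib)
  finally have 1: "(exp r * r powr (N + 1) / (\<epsilon> * Gamma (N + 2))) powr (1 / N) =
      exp (ln (exp r * r / \<epsilon>) * (1 / N) + ln r - ln_Gamma (N + 2) / N)" .
  have 2: "real d powr (N + 1) / ((real d - 1) * N) =
      exp ((N + 1) * ln (real d) - ln (real d - 1) - ln N)"
    using assms by (simp add: powr_def exp_diff exp_ln)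
  have 3: "ln (real d * r / (real d - 1)) = ln (real d) + ln r - ln (real d - 1)"
    using assms by (simp add: ln_mult ln_div)
  show ?thesis
    unfolding phi_def 1 2 3 exp_add[symmetric] by (simp add: algebra_simps)
qed

lemma phi_pos:
  assumes "d \<ge> 2" "r > 0" "\<epsilon> > 0" "N > 0"
  shows "phi d r \<epsilon> N > 0"
  by (simp add: phi_eq_exp assms)

lemma strictly_convex_on_phi:
  assumes "d \<ge> 2" "r > 0" "\<epsilon> > 0" "\<epsilon> \<le> exp r * r"
  shows "strictly_convex_on {0<..} (phi d r \<epsilon>)"
proof -
  have K: "ln (exp r * r / \<epsilon>) \<ge> 0"
    using assms by (intro ln_ge_zero) (simp add: field_simps)
  have inv: "convex_on {0<..} (\<lambda>N::real. 1 / N)"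
    by (rule f''_ge0_imp_convex[where f' = "\<lambda>x. - 1 / x\<^sup>2" and f'' = "\<lambda>x. 2 / x ^ 3"])
       (auto intro!: derivative_eq_intros simp: power2_eq_square power3_eq_cube field_simps)
  have lin: "convex_on {0<..} (\<lambda>N::real. N * ln (real d))"
    by (auto simp: convex_on_def algebra_simps)
  have const: "convex_on {0<..} (\<lambda>N::real. ln (real d * r / (real d - 1)))"
    by (auto simp: convex_on_def simp flip: distrib_right)
  have "strictly_convex_on {0<..} (\<lambda>N. exp (- ln N + (- (ln_Gamma (N + 2) / N) +
      (N * ln (real d) + (ln (real d * r / (real d - 1)) + ln (exp r * r / \<epsilon>) * (1 / N))))))"
    using concave_on_ln_Gamma_quotient
    by (intro strictly_convex_on_exp strictly_convex_on_add_convex_on strictly_convex_on_minus_ln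
        convex_on_add convex_on_cmul K inv lin const) (simp add: concave_on_def)
  moreover have "u *\<^sub>R x + v *\<^sub>R y > 0" if "x > 0" "y > 0" "u > 0" "v > 0" for x y u v :: real
    using that by (simp add: add_pos_pos)
  ultimately show ?thesis
    by (simp add: strictly_convex_on_def phi_eq_exp[OF assms(1-3)])
qed

lemma phi_ge:
  assumes "d \<ge> 2" "r > 0" "\<epsilon> > 0" "\<epsilon> \<le> exp r * r" "N > 0"
  shows "phi d r \<epsilon> N \<ge> real d powr (N + 1) / ((real d - 1) * N) * (r / (N + 2))"
proof -
  have K: "ln (exp r * r / \<epsilon>) * (1 / N) \<ge> 0"
    using assms by (intro mult_nonneg_nonneg ln_ge_zero) (simp_all add: field_simps)
  have G: "ln_Gamma (N + 2) / N \<le> ln (N + 2)"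
    using ln_Gamma_add_2_le[of N] assms by (simp add: field_simps)
  have "real d powr (N + 1) / ((real d - 1) * N) * (r / (N + 2)) =
      exp ((N + 1) * ln (real d) - (ln (real d - 1) + ln N) + (ln r - ln (N + 2)))"
    using assms by (simp add: exp_add exp_diff powr_def)
  also have "\<dots> = exp (- ln N + (- ln (N + 2) + (N * ln (real d) +
      ln (real d * r / (real d - 1)))))"
    using assms by (simp add: ln_mult ln_div algebra_simps)
  also have "\<dots> \<le> phi d r \<epsilon> N"
    using K G by (simp add: phi_eq_exp assms)
  finally show ?thesis .
qed

lemma filterlim_phi:
  assumes "d \<ge> 2" "r > 0" "\<epsilon> > 0" "\<epsilon> \<le> exp r * r"
  shows "filterlim (phi d r \<epsilon>) at_top (at_right 0)"
    and "filterlim (phi d r \<epsilon>) at_top at_top"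
proof -
  define D where "D = real d"
  have D: "D > 1" "D > 0" "D - 1 > 0" using assms by (auto simp: D_def)
  let ?g = "\<lambda>N. D powr (N + 1) / ((D - 1) * N) * (r / (N + 2))"
  have g: "filterlim ?g at_top (at_right 0)" "filterlim ?g at_top at_top"
    using D assms by real_asymp+
  have le: "?g N \<le> phi d r \<epsilon> N" if "N > 0" for N
    unfolding D_def using assms that by (rule phi_ge)
  have "\<forall>\<^sub>F N in at_right 0. ?g N \<le> phi d r \<epsilon> N"
    using eventually_at_right_less[of 0] by (rule eventually_mono) (rule le)
  thus "filterlim (phi d r \<epsilon>) at_top (at_right 0)"
    by (rule filterlim_at_top_mono[OF g(1)])
  have "\<forall>\<^sub>F N in at_top. ?g N \<le> phi d r \<epsilon> N"
    using eventually_gt_at_top[of 0] by (rule eventually_mono) (rule le)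
  thus "filterlim (phi d r \<epsilon>) at_top at_top"
    by (rule filterlim_at_top_mono[OF g(2)])
qed


section \<open>The constraint\<close>

text \<open>For each \<open>N > 0\<close>, this is the only \<open>m > 0\<close> with \<open>err r N m = \<epsilon>\<close>.\<close>

definition constraint_m :: "real \<Rightarrow> real \<Rightarrow> real \<Rightarrow> real" where
  "constraint_m r \<epsilon> N = (exp r * r powr (N + 1) / (\<epsilon> * Gamma (N + 2))) powr (1 / N)"

lemma constraint_m_pos:
  assumes "r > 0" "\<epsilon> > 0" "N > 0"
  shows "constraint_m r \<epsilon> N > 0"
  using assms Gamma_real_pos[of "N + 2"]
  by (auto simp: constraint_m_def less_imp_neq[symmetric])

lemma err_eq_iff:
  assumes "r > 0" "\<epsilon> > 0" "N > 0" "m > 0"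
  shows "err r N m = \<epsilon> \<longleftrightarrow> m = constraint_m r \<epsilon> N"
proof -
  define A where "A = exp r * r powr (N + 1) / (\<epsilon> * Gamma (N + 2))"
  have G: "Gamma (N + 2) > 0"
    using assms by (intro Gamma_real_pos) auto
  have A: "A > 0"
    using assms G by (simp add: A_def)
  have "err r N m = \<epsilon> \<longleftrightarrow> m powr N = A"
    using assms less_imp_neq[OF G] by (auto simp: err_def A_def field_simps)
  also have "\<dots> \<longleftrightarrow> m = A powr (1 / N)"
    using assms A by (auto simp: powr_powr)
  finally show ?thesis by (simp add: constraint_m_def A_def)
qed

lemma cost_constraint_m: "cost d N (constraint_m r \<epsilon> N) = phi d r \<epsilon> N"
  by (simp add: cost_def constraint_m_def phi_def)

theorem lemma1p4:
  fixes d :: nat and r \<epsilon> :: real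
  assumes "d \<ge> 2" and "r > 0" and "\<epsilon> > 0" and "\<epsilon> \<le> exp r * r"
  shows "phi d r \<epsilon> \<in> {0<..} \<rightarrow> {0<..}
    \<and> filterlim (phi d r \<epsilon>) at_top (at_right 0)
    \<and> filterlim (phi d r \<epsilon>) at_top at_top
    \<and> strictly_convex_on {0<..} (phi d r \<epsilon>)
    \<and> (\<exists>!p. is_arg_min (\<lambda>(N, m). cost d N m)
                       (\<lambda>(N, m). N > 0 \<and> m > 0 \<and> err r N m = \<epsilon>) p)"
proof (intro conjI)
  show "phi d r \<epsilon> \<in> {0<..} \<rightarrow> {0<..}"
    using assms by (auto intro: phi_pos)
  show lims: "filterlim (phi d r \<epsilon>) at_top (at_right 0)"
             "filterlim (phi d r \<epsilon>) at_top at_top"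
    using filterlim_phi assms by blast+
  show conv: "strictly_convex_on {0<..} (phi d r \<epsilon>)"
    using assms by (rule strictly_convex_on_phi)
  let ?P = "\<lambda>(N, m). N > 0 \<and> m > 0 \<and> err r N m = \<epsilon>"
  have feasible: "?P (N, m) \<longleftrightarrow> N > 0 \<and> m = constraint_m r \<epsilon> N" for N m
    using err_eq_iff constraint_m_pos assms by auto
  have argmin: "is_arg_min (\<lambda>(N, m). cost d N m) ?P (N, m) \<longleftrightarrow>
      (N > 0 \<and> (\<forall>y>0. phi d r \<epsilon> N \<le> phi d r \<epsilon> y)) \<and> m = constraint_m r \<epsilon> N" for N m
    unfolding is_arg_min_def split_paired_Ex feasible
    by (auto simp: cost_constraint_m not_less) (meson not_le)
  obtain N where N: "N > 0 \<and> (\<forall>y>0. phi d r \<epsilon> N \<le> phi d r \<epsilon> y)"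
    and uniq: "\<And>M. M > 0 \<and> (\<forall>y>0. phi d r \<epsilon> M \<le> phi d r \<epsilon> y) \<Longrightarrow> M = N"
    using strictly_convex_ex1_minimiser[OF conv lims] by blast
  show "\<exists>!p. is_arg_min (\<lambda>(N, m). cost d N m) ?P p"
  proof (rule ex1I[of _ "(N, constraint_m r \<epsilon> N)"])
    show "is_arg_min (\<lambda>(N, m). cost d N m) ?P (N, constraint_m r \<epsilon> N)"
      unfolding argmin using N by simp
  next
    fix p
    assume p: "is_arg_min (\<lambda>(N, m). cost d N m) ?P p"
    obtain M m where "p = (M, m)" by (cases p)
    with p show "p = (N, constraint_m r \<epsilon> N)"
      using uniq[of M] by (simp only: argmin) simp
  qed
qed

end
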